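(* The function $Q\in[\mathcal{M}_{\mathcal{F}};\tau_{\mathcal{F}}]\mapsto\phi(Q,P)\in[0,+\infty]$ is the conjugate of its conjugate $f\in[\langle\mathcal{F}\cup\mathcal{B}_b\rangle;\tau_{\mathcal{M}}]\mapsto\phi^*(f)$, where $$\phi^*(f):=\sup_{Q\in\mathcal{M}_{\mathcal{F}}}\left\{\int f\,dQ-\phi(Q,P)\right\}.$$ In other words, the $\phi$-divergence admits the dual representation $$\phi(Q,P)=\sup_{f\in\langle\mathcal{F}\cup\mathcal{B}_b\rangle}\left\{\int f\,dQ-\phi^*(f)\right\}\quad\text{for all }Q\in\mathcal{M}_{\mathcal{F}}.$$
   Context: $(\mathcal{X},\mathcal{B})$ is a measurable space and $P$ a given probability measure on it. $\mathcal{M}$ is the real vector space of all signed finite measures on $(\mathcal{X},\mathcal{B})$, and $\mathcal{M}(P)$ the subspace of those absolutely continuous w.r.t. $P$. The function $\varphi:\mathbb{R}\to[0,+\infty]$ is proper, convex and closed, with $\varphi(1)=0$, and its domain $\{x:\varphi(x)<\infty\}$ is an interval with endpoints $a_\varphi<1<b_\varphi$ (finite or infinite). Closed means that $\varphi(x)\to\varphi(a_\varphi)$ as $x\downarrow a_\varphi$ if $a_\varphi$ is finite, and $\varphi(x)\to\varphi(b_\varphi)$ as $x\uparrow b_\varphi$ if $b_\varphi$ is finite (equivalently, $\varphi$ is lower semi-continuous). For $Q\in\mathcal{M}(P)$ put $\phi(Q,P):=\int_{\mathcal{X}}\varphi\left(\frac{dQ}{dP}\right)dP$, and $\phi(Q,P):=+\infty$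 if $Q\in\mathcal{M}\setminus\mathcal{M}(P)$. $\mathcal{F}$ is a class (not assumed finite) of measurable real valued functions on $\mathcal{X}$, bounded or unbounded; $\mathcal{B}_b$ is the set of all bounded measurable real valued functions on $\mathcal{X}$; $\langle\mathcal{F}\cup\mathcal{B}_b\rangle$ is the linear span of $\mathcal{F}\cup\mathcal{B}_b$; $\mathcal{M}_{\mathcal{F}}:=\{Q\in\mathcal{M}:\int|f|\,d|Q|<\infty\text{ for all }f\in\mathcal{F}\}$, where $|Q|$ is the total variation of $Q$. $\tau_{\mathcal{F}}$ is the weakest topology on $\mathcal{M}_{\mathcal{F}}$ for which all maps $Q\mapsto\int f\,dQ$, $f\in\mathcal{F}\cup\mathcal{B}_b$, are continuous; $\tau_{\mathcal{M}}$ is the weakest topology on $\langle\mathcal{F}\cup\mathcal{B}_b\rangle$ for which all maps $f\mapsto\int f\,dQ$, $Q\in\mathcal{M}_{\mathcal{F}}$, are continuous. Conjugates are taken with respect to the pairing $(f,Q)\mapsto\int f\,dQ$. *)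

theory Defs
  imports "HOL-Probability.Probability"
begin

section \<open>Finite signed measures on a measurable space\<close>

text \<open>A measurable space is given by \<^term>\<open>space M\<close> and \<^term>\<open>sets M\<close> of some
  \<^term>\<open>M :: 'a measure\<close>; the values \<^term>\<open>emeasure M\<close> are irrelevant unless \<^term>\<open>M\<close>
  is the reference probability.  A finite signed measure is a real set function; it is set to
  \<open>0\<close> on non-measurable sets so that each signed measure has exactly one representative.\<close>

definition signed_measures :: "'a measure \<Rightarrow> ('a set \<Rightarrow> real) set" where
  "signed_measures M = {Q.
     Q {} = 0 \<and>
     (\<forall>A :: nat \<Rightarrow> 'a set. range A \<subseteq> sets M \<longrightarrow> disjoint_family A \<longrightarrow>
        (\<lambda>i. Q (A i)) sums Q (\<Union>i. A i)) \<and>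
     (\<forall>A. A \<notin> sets M \<longrightarrow> Q A = 0)}"

text \<open>Jordan decomposition.  As \<^term>\<open>Q {} = (0::real)\<close>, the truncation of negative values by
  \<^const>\<open>ennreal\<close> does not change the supremum \<open>sup {Q B | B \<subseteq> A}\<close>.\<close>

definition pos_variation :: "'a measure \<Rightarrow> ('a set \<Rightarrow> real) \<Rightarrow> 'a measure" where
  "pos_variation M Q =
     measure_of (space M) (sets M) (\<lambda>A. SUP B\<in>{B \<in> sets M. B \<subseteq> A}. ennreal (Q B))"

definition neg_variation :: "'a measure \<Rightarrow> ('a set \<Rightarrow> real) \<Rightarrow> 'a measure" where
  "neg_variation M Q = pos_variation M (\<lambda>A. - Q A)"

definition total_variation :: "'a measure \<Rightarrow> ('a set \<Rightarrow> real) \<Rightarrow> 'a measure" where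
  "total_variation M Q =
     measure_of (space M) (sets M)
       (\<lambda>A. emeasure (pos_variation M Q) A + emeasure (neg_variation M Q) A)"

definition signed_integral :: "'a measure \<Rightarrow> ('a set \<Rightarrow> real) \<Rightarrow> ('a \<Rightarrow> real) \<Rightarrow> real" where
  "signed_integral M Q f =
     (\<integral>x. f x \<partial>pos_variation M Q) - (\<integral>x. f x \<partial>neg_variation M Q)"

definition abs_cont :: "'a measure \<Rightarrow> ('a set \<Rightarrow> real) \<Rightarrow> bool" where
  "abs_cont P Q \<longleftrightarrow> (\<forall>A\<in>null_sets P. Q A = 0)"

text \<open>Real-valued version of \<^const>\<open>RN_deriv\<close>: it is determined \<open>P\<close>-almost everywhere whenever
  \<open>Q\<close> is a finite signed measure absolutely continuous with respect to \<open>P\<close>.\<close>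

definition signed_RN_deriv :: "'a measure \<Rightarrow> ('a set \<Rightarrow> real) \<Rightarrow> 'a \<Rightarrow> real" where
  "signed_RN_deriv P Q =
     (SOME q. integrable P q \<and> (\<forall>A\<in>sets P. Q A = (LINT x:A|P. q x)))"

definition phi_divergence ::
  "(real \<Rightarrow> ennreal) \<Rightarrow> 'a measure \<Rightarrow> ('a set \<Rightarrow> real) \<Rightarrow> ennreal" where
  "phi_divergence \<phi> P Q =
     (if abs_cont P Q then (\<integral>\<^sup>+x. \<phi> (signed_RN_deriv P Q x) \<partial>P) else \<infinity>)"


section \<open>Spaces in duality and their weak topologies\<close>

definition bounded_measurable :: "'a measure \<Rightarrow> ('a \<Rightarrow> real) set" where
  "bounded_measurable M = {f \<in> borel_measurable M. bounded (f ` space M)}"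

definition fun_span :: "('a \<Rightarrow> real) set \<Rightarrow> ('a \<Rightarrow> real) set" where
  "fun_span G = {\<lambda>x. \<Sum>g\<in>S. c g * g x | S c. finite S \<and> S \<subseteq> G}"

definition test_functions :: "'a measure \<Rightarrow> ('a \<Rightarrow> real) set \<Rightarrow> ('a \<Rightarrow> real) set" where
  "test_functions M F = fun_span (F \<union> bounded_measurable M)"

definition signed_measures_F :: "'a measure \<Rightarrow> ('a \<Rightarrow> real) set \<Rightarrow> ('a set \<Rightarrow> real) set" where
  "signed_measures_F M F =
     {Q \<in> signed_measures M. \<forall>f\<in>F. (\<integral>\<^sup>+x. ennreal \<bar>f x\<bar> \<partial>total_variation M Q) < \<infinity>}"

definition weakest_topology :: "'b set \<Rightarrow> ('b \<Rightarrow> real) set \<Rightarrow> 'b topology" where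
  "weakest_topology X H =
     topology_generated_by (insert X {{x \<in> X. h x \<in> U} | h U. h \<in> H \<and> open U})"

lemma topspace_weakest_topology: "topspace (weakest_topology X H) = X"
  unfolding weakest_topology_def topology_generated_by_topspace by auto

lemma continuous_map_weakest_topology:
  assumes "h \<in> H"
  shows "continuous_map (weakest_topology X H) euclideanreal h"
proof -
  have "openin (weakest_topology X H) {x \<in> X. h x \<in> U}" if "open U" for U
    unfolding weakest_topology_def using assms that
    by (intro topology_generated_by_Basis) blast
  then show ?thesis
    by (simp add: continuous_map_def topspace_weakest_topology)
qed

lemma weakest_topology_weakest:
  assumes "topspace T = X" and "\<And>h. h \<in> H \<Longrightarrow> continuous_map T euclideanreal h"
    and "openin (weakest_topology X H) S"
  shows "openin T S"
proof -
  have basis: "openin T V"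
    if "V \<in> insert X {{x \<in> X. h x \<in> U} | h U. h \<in> H \<and> open U}" for V
    using that assms(1,2) openin_continuous_map_preimage
    by (force simp: continuous_map_def)
  have "generate_topology_on (insert X {{x \<in> X. h x \<in> U} | h U. h \<in> H \<and> open U}) S"
    using assms(3) unfolding weakest_topology_def by (simp add: openin_topology_generated_by_iff)
  then show ?thesis
    by induction (auto intro: basis)
qed

definition tau_F :: "'a measure \<Rightarrow> ('a \<Rightarrow> real) set \<Rightarrow> ('a set \<Rightarrow> real) topology" where
  "tau_F M F = weakest_topology (signed_measures_F M F)
     ((\<lambda>f Q. signed_integral M Q f) ` (F \<union> bounded_measurable M))"

definition tau_M :: "'a measure \<Rightarrow> ('a \<Rightarrow> real) set \<Rightarrow> ('a \<Rightarrow> real) topology" where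
  "tau_M M F = weakest_topology (test_functions M F)
     (signed_integral M ` signed_measures_F M F)"


section \<open>Conjugates\<close>

text \<open>Conjugate, with respect to a pairing, of a function on a topological space.  Only the
  carrier of the space enters, since the dual is specified by the pairing.  Pairings are
  real-valued, so \<^term>\<open>ereal (pair x y) - g x\<close> is never of the form \<open>\<infinity> - \<infinity>\<close>.\<close>

definition conjugate ::
  "'b topology \<Rightarrow> ('b \<Rightarrow> 'c \<Rightarrow> real) \<Rightarrow> ('b \<Rightarrow> ereal) \<Rightarrow> 'c \<Rightarrow> ereal" where
  "conjugate T pair g y = (SUP x\<in>topspace T. ereal (pair x y) - g x)"

definition phi_star ::
  "(real \<Rightarrow> ennreal) \<Rightarrow> 'a measure \<Rightarrow> ('a \<Rightarrow> real) set \<Rightarrow> ('a \<Rightarrow> real) \<Rightarrow> ereal" where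
  "phi_star \<phi> P F f =
     (SUP Q\<in>signed_measures_F P F.
        ereal (signed_integral P Q f) - enn2ereal (phi_divergence \<phi> P Q))"

end

theory Submission
  imports Defs
begin

text \<open>
  One inequality is Young's: \<^const>\<open>phi_star\<close> is a supremum over all \<open>Q\<close>, so
  \<open>\<integral>f dQ - \<phi>*(f)\<close> never exceeds the divergence of \<open>Q\<close>
  (\<open>weak_duality\<close>).  For the converse no separation argument in the space of measures is made:
  the supremum is approached along explicit bounded test functions, so that convexity is used only on
  the real line.

  If \<open>Q\<close> charges a \<open>P\<close>-null set \<open>A\<close>, then multiples of the indicator of \<open>A\<close> have
  \<open>\<phi>*(f) \<le> 0\<close>, since every measure of finite divergence ignores \<open>A\<close>, while
  their integrals against \<open>Q\<close> are arbitrarily large.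

  If \<open>Q\<close> has a density \<open>q\<close>, write \<open>\<phi>\<close> as a countable supremum of affine functions
  \<open>y \<mapsto> \<alpha> y - \<beta>\<close> (\<open>countable_sup_of_affine_minorants\<close>), and let
  \<open>f x\<close> and \<open>i x\<close> be the slope \<open>\<alpha>\<close> and the \<open>\<beta>\<close> of the one that is largest at
  \<open>q x\<close> among the zero function and the first \<open>n\<close> of them.  Both functions take finitely many values.  As
  \<open>f x * z - i x \<le> \<phi> z\<close> for all \<open>z\<close>, integrating with the density of any
  absolutely continuous \<open>R\<close> in place of \<open>z\<close> gives \<open>\<phi>*(f) \<le> \<integral>i dP\<close>
  (\<open>phi_star_le_integral_intercept\<close>).  Hence \<open>\<integral>f dQ - \<phi>*(f)\<close> is at least
  \<open>\<integral>(f q - i) dP\<close>, the integral of the maximum of these affine functions at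
  \<open>q\<close>, and this increases to \<open>\<integral>\<phi>(q) dP\<close> by monotone convergence.

  The measure theory behind this is the Jordan decomposition of a finite signed measure, which gives it
  a real density by the theorem of Radon and Nikodym, and the formula
  \<open>\<integral>f dQ = \<integral>f q dP\<close> for bounded \<open>f\<close> (\<open>signed_integral_density\<close>).
\<close>

section \<open>Jordan decomposition of finite signed measures\<close>

lemma signed_measures_countably_additive:
  assumes "Q \<in> signed_measures M" "range A \<subseteq> sets M" "disjoint_family A"
  shows "(\<lambda>i. Q (A i)) sums Q (\<Union>i. A i)"
  using assms unfolding signed_measures_def by blast

lemma signed_measures_empty: "Q \<in> signed_measures M \<Longrightarrow> Q {} = 0"
  unfolding signed_measures_def by blast

lemma signed_measures_Un:
  assumes Q: "Q \<in> signed_measures M" and "A \<in> sets M" "B \<in> sets M" "A \<inter> B = {}"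
  shows "Q (A \<union> B) = Q A + Q B"
proof -
  have "(\<lambda>i. Q (binaryset A B i)) sums Q (\<Union>i. binaryset A B i)"
    using assms by (intro signed_measures_countably_additive)
      (auto simp: range_binaryset_eq disjoint_family_on_def binaryset_def)
  then have "(\<lambda>i. Q (binaryset A B i)) sums Q (A \<union> B)"
    by (simp add: UN_binaryset_eq)
  moreover have "(\<lambda>i. Q (binaryset A B i)) sums (Q A + Q B)"
    by (rule binaryset_sums) (simp add: signed_measures_empty[OF Q])
  ultimately show ?thesis
    by (rule sums_unique2)
qed

lemma signed_measures_Diff:
  assumes Q: "Q \<in> signed_measures M" and "A \<in> sets M" "B \<in> sets M" "B \<subseteq> A"
  shows "Q (A - B) = Q A - Q B"
proof -
  have "Q (B \<union> (A - B)) = Q B + Q (A - B)"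
    using assms by (intro signed_measures_Un[OF Q]) auto
  moreover have "B \<union> (A - B) = A"
    using assms by auto
  ultimately show ?thesis by simp
qed

lemma signed_measures_uminus:
  assumes "Q \<in> signed_measures M"
  shows "(\<lambda>A. - Q A) \<in> signed_measures M"
  using assms unfolding signed_measures_def by (auto intro: sums_minus)

text \<open>Exhaustion: if \<open>Q\<close> is unbounded on the subsets of \<open>E\<close>, then \<open>E\<close> splits into two
  pieces, on one of which \<open>Q\<close> is still unbounded, while the other has absolute mass above \<open>1\<close>.
  Repeating this with the unbounded piece cuts off disjoint sets whose masses do not tend to \<open>0\<close>,
  which contradicts countable additivity.\<close>

lemma signed_measures_bounded:
  assumes Q: "Q \<in> signed_measures M"
  shows "\<exists>K. \<forall>B\<in>sets M. \<bar>Q B\<bar> \<le> K"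
proof (rule ccontr)
  assume unbounded: "\<nexists>K. \<forall>B\<in>sets M. \<bar>Q B\<bar> \<le> K"
  define unb where "unb E \<longleftrightarrow> (\<forall>K. \<exists>B\<in>sets M. B \<subseteq> E \<and> \<bar>Q B\<bar> > K)" for E
  have shrink: "\<exists>E'. (E' \<in> sets M \<and> unb E') \<and> E' \<subseteq> E \<and> \<bar>Q (E - E')\<bar> > 1"
    if E: "E \<in> sets M" "unb E" for E
  proof -
    \<comment> \<open>By additivity the bound makes both \<open>B\<close> and its complement in \<open>E\<close> heavier than \<open>1\<close>.\<close>
    obtain B where B: "B \<in> sets M" "B \<subseteq> E" "\<bar>Q B\<bar> > 1 + \<bar>Q E\<bar>"
      using E(2) unfolding unb_def by blast
    show ?thesis
    proof (cases "unb B")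
      case True
      have "\<bar>Q (E - B)\<bar> > 1"
        using B signed_measures_Diff[OF Q E(1) B(1,2)] by linarith
      then show ?thesis using True B by blast
    next
      case False
      then obtain K where K: "\<And>C. C \<in> sets M \<Longrightarrow> C \<subseteq> B \<Longrightarrow> \<bar>Q C\<bar> \<le> K"
        unfolding unb_def by (meson not_less)
      have "unb (E - B)"
        unfolding unb_def
      proof
        fix L
        obtain C where C: "C \<in> sets M" "C \<subseteq> E" "\<bar>Q C\<bar> > L + K"
          using E(2) unfolding unb_def by blast
        have "Q (C - C \<inter> B) = Q C - Q (C \<inter> B)"
          using C(1) B(1) by (intro signed_measures_Diff[OF Q]) auto
        then have "Q (C - B) = Q C - Q (C \<inter> B)"
          by (simp only: Diff_Int Diff_cancel Un_empty_left)
        moreover have "\<bar>Q (C \<inter> B)\<bar> \<le> K"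
          using C(1) B(1) by (intro K) auto
        ultimately have "\<bar>Q (C - B)\<bar> > L"
          using C(3) by linarith
        then show "\<exists>B'\<in>sets M. B' \<subseteq> E - B \<and> \<bar>Q B'\<bar> > L"
          using C(1,2) B(1) by (intro bexI[of _ "C - B"]) auto
      qed
      moreover have "E - (E - B) = B"
        using B by auto
      ultimately show ?thesis
        using B E(1) by (intro exI[of _ "E - B"]) auto
    qed
  qed
  have "unb (space M)"
    unfolding unb_def
  proof
    fix K
    obtain B where "B \<in> sets M" "K < \<bar>Q B\<bar>"
      using unbounded by (auto simp: not_le)
    then show "\<exists>B\<in>sets M. B \<subseteq> space M \<and> K < \<bar>Q B\<bar>"
      using sets.sets_into_space by blast
  qed
  then have start: "\<exists>E. E \<in> sets M \<and> unb E"
    by blast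
  have "\<exists>E. \<forall>n::nat. (E n \<in> sets M \<and> unb (E n)) \<and>
      (E (Suc n) \<subseteq> E n \<and> \<bar>Q (E n - E (Suc n))\<bar> > 1)"
    using start shrink by (intro dependent_nat_choice) auto
  then obtain E where E: "\<And>n::nat. E n \<in> sets M"
      and step: "\<And>n. E (Suc n) \<subseteq> E n" "\<And>n. \<bar>Q (E n - E (Suc n))\<bar> > 1"
    by blast
  have antitone: "E n \<subseteq> E m" if "m \<le> n" for m n
    using step(1) that by (rule lift_Suc_antimono_le)
  have "disjoint_family (\<lambda>n. E n - E (Suc n))"
    unfolding disjoint_family_on_def
  proof (intro ballI impI)
    fix m n :: nat assume "m \<noteq> n"
    then show "(E m - E (Suc m)) \<inter> (E n - E (Suc n)) = {}"
      using antitone[of "Suc m" n] antitone[of "Suc n" m]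
      by (cases "m < n") auto
  qed
  then have "(\<lambda>n. Q (E n - E (Suc n))) sums Q (\<Union>n. E n - E (Suc n))"
    using E by (intro signed_measures_countably_additive[OF Q]) auto
  then have "(\<lambda>n. Q (E n - E (Suc n))) \<longlonglongrightarrow> 0"
    by (intro summable_LIMSEQ_zero sums_summable)
  then have "\<forall>\<^sub>F n in sequentially. \<bar>Q (E n - E (Suc n))\<bar> < 1"
    by (auto dest: tendstoD[where e = 1])
  then obtain N where "\<bar>Q (E N - E (Suc N))\<bar> < 1"
    unfolding eventually_sequentially by blast
  then show False
    using step(2)[of N] by simp
qed

text \<open>The coercion truncates negative terms, and the series on the right is taken in
  \<^typ>\<open>ennreal\<close>, so \<open>f\<close> may change sign and may fail to converge absolutely.\<close>

lemma ennreal_sums_le_suminf: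
  assumes "f sums s"
  shows "ennreal s \<le> (\<Sum>i. ennreal (f i))"
proof (rule LIMSEQ_le_const2)
  show "(\<lambda>n. ennreal (\<Sum>i<n. f i)) \<longlonglongrightarrow> ennreal s"
    using assms unfolding sums_def by (rule tendsto_ennrealI)
  have sub: "ennreal (sum f I) \<le> (\<Sum>i\<in>I. ennreal (f i))" if "finite I" for I :: "nat set"
  proof -
    have "ennreal (sum f I) \<le> ennreal (\<Sum>i\<in>I. max 0 (f i))"
      by (intro ennreal_leI sum_mono) auto
    also have "\<dots> = (\<Sum>i\<in>I. ennreal (max 0 (f i)))"
      by (rule sum_ennreal[symmetric]) auto
    finally show ?thesis by simp
  qed
  show "\<exists>N. \<forall>n\<ge>N. ennreal (\<Sum>i<n. f i) \<le> (\<Sum>i. ennreal (f i))"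
    by (intro exI allI impI order_trans[OF sub] sum_le_suminf) auto
qed

lemma sets_pos_variation [simp]: "sets (pos_variation M Q) = sets M"
  unfolding pos_variation_def by (simp add: sets.space_closed sets.sigma_sets_eq)

lemma sets_neg_variation [simp]: "sets (neg_variation M Q) = sets M"
  unfolding neg_variation_def by simp

text \<open>\<^const>\<open>pos_variation\<close> is built by \<^const>\<open>measure_of\<close>, which returns the given set function
  only if that is countably additive.  It is subadditive because any \<open>B\<close> inside the union is cut
  into the pieces \<open>B \<inter> A i\<close>, and superadditive because near-optimal subsets of disjoint sets can
  be united.\<close>

lemma emeasure_pos_variation:
  assumes Q: "Q \<in> signed_measures M" and A: "A \<in> sets M"
  shows "emeasure (pos_variation M Q) A = (SUP B\<in>{B \<in> sets M. B \<subseteq> A}. ennreal (Q B))"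
proof -
  define \<mu> where "\<mu> A = (SUP B\<in>{B \<in> sets M. B \<subseteq> A}. ennreal (Q B))" for A
  have upper: "ennreal (Q B) \<le> \<mu> A" if "B \<in> sets M" "B \<subseteq> A" for A B
    unfolding \<mu>_def using that by (intro SUP_upper) auto
  have mono: "\<mu> A \<le> \<mu> B" if "A \<subseteq> B" for A B
    unfolding \<mu>_def using that by (intro SUP_subset_mono) auto
  have superadditive: "\<mu> A + \<mu> B \<le> \<mu> (A \<union> B)" if disj: "A \<inter> B = {}" for A B
  proof -
    have pair: "ennreal (Q C) + ennreal (Q D) \<le> \<mu> (A \<union> B)"
      if C: "C \<in> sets M" "C \<subseteq> A" and D: "D \<in> sets M" "D \<subseteq> B" for C D
    proof (cases "Q C \<ge> 0 \<and> Q D \<ge> 0")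
      case True
      have "C \<inter> D = {}"
        using disj C D by auto
      then have "ennreal (Q C) + ennreal (Q D) = ennreal (Q (C \<union> D))"
        using True C D by (simp add: signed_measures_Un[OF Q] ennreal_plus)
      also have "\<dots> \<le> \<mu> (A \<union> B)"
        using C D by (intro upper) auto
      finally show ?thesis .
    next
      case False
      \<comment> \<open>A subset of negative mass counts as \<open>0\<close>, so the other one alone does the job.\<close>
      then consider "ennreal (Q C) = 0" | "ennreal (Q D) = 0"
        by (force simp: ennreal_eq_0_iff)
      then show ?thesis
        using upper[of C "A \<union> B"] upper[of D "A \<union> B"] C D by cases auto
    qed
    have ne: "{C \<in> sets M. C \<subseteq> A} \<noteq> {}" for A
      by blast
    have left: "ennreal (Q C) + \<mu> B \<le> \<mu> (A \<union> B)" if "C \<in> sets M" "C \<subseteq> A" for C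
      unfolding \<mu>_def[of B] ennreal_SUP_add_right[OF ne]
      using pair that by (intro SUP_least) simp
    show ?thesis
      unfolding \<mu>_def[of A] ennreal_SUP_add_left[OF ne, symmetric]
      using left by (intro SUP_least) simp
  qed
  have "countably_additive (sets M) \<mu>"
    unfolding countably_additive_def
  proof (intro allI impI antisym)
    fix A :: "nat \<Rightarrow> 'a set"
    assume A: "range A \<subseteq> sets M" "disjoint_family A"
    have "(\<Sum>i<n. \<mu> (A i)) \<le> \<mu> (\<Union>i<n. A i)" for n
    proof (induction n)
      case (Suc n)
      have "A i \<inter> A n = {}" if "i < n" for i
        using disjoint_family_onD[OF A(2), of i n] that by simp
      then have disj: "(\<Union>i<n. A i) \<inter> A n = {}"
        by blast
      have "(\<Sum>i<Suc n. \<mu> (A i)) \<le> \<mu> (\<Union>i<n. A i) + \<mu> (A n)"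
        using Suc by (simp add: add_right_mono)
      also have "\<dots> \<le> \<mu> ((\<Union>i<n. A i) \<union> A n)"
        by (rule superadditive[OF disj])
      also have "(\<Union>i<n. A i) \<union> A n = (\<Union>i<Suc n. A i)"
        by (auto simp: less_Suc_eq)
      finally show ?case .
    qed simp
    then have "(\<Sum>i<n. \<mu> (A i)) \<le> \<mu> (\<Union>i. A i)" for n
      by (rule order_trans) (auto intro: mono)
    then show "(\<Sum>i. \<mu> (A i)) \<le> \<mu> (\<Union>i. A i)"
      by (simp add: suminf_eq_SUP SUP_least)
    show "\<mu> (\<Union>i. A i) \<le> (\<Sum>i. \<mu> (A i))"
      unfolding \<mu>_def[of "\<Union>i. A i"]
    proof (rule SUP_least)
      fix B assume B: "B \<in> {B \<in> sets M. B \<subseteq> (\<Union>i. A i)}"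
      have "(\<lambda>i. Q (B \<inter> A i)) sums Q (\<Union>i. B \<inter> A i)"
        using A B by (intro signed_measures_countably_additive[OF Q])
          (auto simp: disjoint_family_on_def)
      also have "(\<Union>i. B \<inter> A i) = B"
        using B by auto
      finally have "ennreal (Q B) \<le> (\<Sum>i. ennreal (Q (B \<inter> A i)))"
        by (rule ennreal_sums_le_suminf)
      also have "\<dots> \<le> (\<Sum>i. \<mu> (A i))"
        using A B by (intro suminf_le upper) auto
      finally show "ennreal (Q B) \<le> (\<Sum>i. \<mu> (A i))" .
    qed
  qed
  moreover have "\<mu> {} = 0"
    using signed_measures_empty[OF Q] by (auto simp: \<mu>_def)
  ultimately have "emeasure (pos_variation M Q) A = \<mu> A"
    using A
    by (intro emeasure_measure_of[OF pos_variation_def[of M Q, folded \<mu>_def]])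
      (auto simp: positive_def sets.space_closed)
  then show ?thesis unfolding \<mu>_def .
qed

lemma finite_measure_pos_variation:
  assumes Q: "Q \<in> signed_measures M"
  shows "finite_measure (pos_variation M Q)"
proof
  obtain K where K: "\<And>B. B \<in> sets M \<Longrightarrow> \<bar>Q B\<bar> \<le> K"
    using signed_measures_bounded[OF Q] by blast
  have sp: "space (pos_variation M Q) = space M"
    by (rule sets_eq_imp_space_eq) simp
  have "emeasure (pos_variation M Q) (space M) \<le> ennreal K"
    unfolding emeasure_pos_variation[OF Q sets.top]
  proof (rule SUP_least)
    fix B assume "B \<in> {B \<in> sets M. B \<subseteq> space M}"
    then have "Q B \<le> K"
      using K[of B] by simp
    then show "ennreal (Q B) \<le> ennreal K"
      by (rule ennreal_leI)
  qed
  also have "ennreal K < \<infinity>"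
    by simp
  finally show "emeasure (pos_variation M Q) (space (pos_variation M Q)) \<noteq> \<infinity>"
    unfolding sp by simp
qed

lemma finite_measure_neg_variation:
  assumes "Q \<in> signed_measures M"
  shows "finite_measure (neg_variation M Q)"
  unfolding neg_variation_def
  by (intro finite_measure_pos_variation signed_measures_uminus assms)

text \<open>Every \<open>B \<subseteq> A\<close> satisfies \<open>Q B = Q A - Q (A - B)\<close>, and \<open>- Q (A - B)\<close> is at most
  the negative variation of \<open>A\<close>.  Applied to \<open>Q\<close> and to \<open>- Q\<close>, the resulting inequality
  yields the Jordan decomposition without a Hahn set.\<close>

lemma measure_pos_variation_le:
  assumes Q: "Q \<in> signed_measures M" and A: "A \<in> sets M"
  shows "measure (pos_variation M Q) A \<le> Q A + measure (neg_variation M Q) A"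
proof -
  interpret p: finite_measure "pos_variation M Q"
    by (rule finite_measure_pos_variation[OF Q])
  interpret n: finite_measure "neg_variation M Q"
    by (rule finite_measure_neg_variation[OF Q])
  have le: "Q B \<le> Q A + measure (neg_variation M Q) A" if B: "B \<in> sets M" "B \<subseteq> A" for B
  proof -
    have "ennreal (- Q (A - B)) \<le> emeasure (neg_variation M Q) A"
      unfolding neg_variation_def emeasure_pos_variation[OF signed_measures_uminus[OF Q] A]
      using A B by (intro SUP_upper) auto
    then have "- Q (A - B) \<le> measure (neg_variation M Q) A"
      by (simp add: n.emeasure_eq_measure ennreal_le_iff)
    then show ?thesis
      using signed_measures_Diff[OF Q A B] by simp
  qed
  have nonneg: "0 \<le> Q A + measure (neg_variation M Q) A"
    using le[of "{}"] signed_measures_empty[OF Q] by simp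
  have "emeasure (pos_variation M Q) A \<le> ennreal (Q A + measure (neg_variation M Q) A)"
    unfolding emeasure_pos_variation[OF Q A] by (rule SUP_least) (simp add: le ennreal_leI)
  then show ?thesis
    using nonneg by (simp add: p.emeasure_eq_measure)
qed

lemma Jordan_decomposition:
  assumes Q: "Q \<in> signed_measures M" and A: "A \<in> sets M"
  shows "Q A = measure (pos_variation M Q) A - measure (neg_variation M Q) A"
  using measure_pos_variation_le[OF Q A] measure_pos_variation_le[OF signed_measures_uminus[OF Q] A]
  by (simp add: neg_variation_def)

lemma signed_integral_indicator:
  assumes Q: "Q \<in> signed_measures M" and A: "A \<in> sets M"
  shows "signed_integral M Q (\<lambda>x. c * indicator A x) = c * Q A"
proof -
  have "A \<inter> space (pos_variation M Q) = A" "A \<inter> space (neg_variation M Q) = A"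
    using A sets.sets_into_space[of A "pos_variation M Q"] sets.sets_into_space[of A "neg_variation M Q"]
    by auto
  then show ?thesis
    by (simp add: signed_integral_def Jordan_decomposition[OF Q A] right_diff_distrib)
qed

section \<open>Signed measures with a density\<close>

lemma ennreal_integral_le_nn_integral:
  assumes "integrable M g"
  shows "ennreal (\<integral>x. g x \<partial>M) \<le> (\<integral>\<^sup>+x. ennreal (g x) \<partial>M)"
proof -
  have "ennreal (\<integral>x. g x \<partial>M) \<le> ennreal (\<integral>x. max 0 (g x) \<partial>M)"
    using assms by (intro ennreal_leI integral_mono) auto
  also have "\<dots> = (\<integral>\<^sup>+x. ennreal (max 0 (g x)) \<partial>M)"
    using assms by (intro nn_integral_eq_integral[symmetric]) auto
  finally show ?thesis by simp
qed

text \<open>The supremum of \<open>Q B\<close> over \<open>B \<subseteq> A\<close> is attained where \<open>q\<close> is positive, and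
  \<^const>\<open>ennreal\<close> cuts \<open>q\<close> off at \<open>0\<close>, so that the density is the positive part of \<open>q\<close>.\<close>

lemma pos_variation_eq_density:
  assumes Q: "Q \<in> signed_measures P" and q: "integrable P q"
    and dens: "\<And>A. A \<in> sets P \<Longrightarrow> Q A = (LINT x:A|P. q x)"
  shows "pos_variation P Q = density P (\<lambda>x. ennreal (q x))"
proof (rule measure_eqI)
  note [measurable] = borel_measurable_integrable[OF q]
  fix A assume "A \<in> sets (pos_variation P Q)"
  then have A [measurable]: "A \<in> sets P" by simp
  have Q_eq: "Q B = (\<integral>x. q x * indicator B x \<partial>P)" and int: "integrable P (\<lambda>x. q x * indicator B x)"
    if "B \<in> sets P" for B
    using that dens[OF that] integrable_mult_indicator[OF that q]
    by (simp_all add: set_lebesgue_integral_def mult.commute)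
  have "(SUP B\<in>{B \<in> sets P. B \<subseteq> A}. ennreal (Q B)) = (\<integral>\<^sup>+x. ennreal (q x) * indicator A x \<partial>P)"
  proof (rule antisym)
    show "(SUP B\<in>{B \<in> sets P. B \<subseteq> A}. ennreal (Q B)) \<le> (\<integral>\<^sup>+x. ennreal (q x) * indicator A x \<partial>P)"
    proof (rule SUP_least)
      fix B assume B: "B \<in> {B \<in> sets P. B \<subseteq> A}"
      then have "ennreal (Q B) \<le> (\<integral>\<^sup>+x. ennreal (q x * indicator B x) \<partial>P)"
        using ennreal_integral_le_nn_integral[OF int] by (simp add: Q_eq)
      also have "\<dots> \<le> (\<integral>\<^sup>+x. ennreal (q x) * indicator A x \<partial>P)"
        using B by (intro nn_integral_mono) (auto split: split_indicator)
      finally show "ennreal (Q B) \<le> (\<integral>\<^sup>+x. ennreal (q x) * indicator A x \<partial>P)" .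
    qed
    define B where "B = {x \<in> space P. x \<in> A \<and> 0 < q x}"
    have B: "B \<in> sets P" "B \<subseteq> A"
      unfolding B_def by auto
    have "(\<integral>\<^sup>+x. ennreal (q x) * indicator A x \<partial>P) = (\<integral>\<^sup>+x. ennreal (q x * indicator B x) \<partial>P)"
      by (intro nn_integral_cong) (auto simp: B_def ennreal_neg split: split_indicator)
    also have "\<dots> = ennreal (Q B)"
      unfolding Q_eq[OF B(1)]
      by (intro nn_integral_eq_integral int B) (auto simp: B_def split: split_indicator)
    also have "\<dots> \<le> (SUP B\<in>{B \<in> sets P. B \<subseteq> A}. ennreal (Q B))"
      using B by (intro SUP_upper) auto
    finally show "(\<integral>\<^sup>+x. ennreal (q x) * indicator A x \<partial>P) \<le> (SUP B\<in>{B \<in> sets P. B \<subseteq> A}. ennreal (Q B))" .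
  qed
  then show "emeasure (pos_variation P Q) A = emeasure (density P (\<lambda>x. ennreal (q x))) A"
    by (simp add: emeasure_pos_variation[OF Q A] emeasure_density)
qed simp

lemma
  assumes q: "integrable P q" and f: "f \<in> bounded_measurable P"
  shows integrable_mult_bounded_measurable: "integrable P (\<lambda>x. f x * q x)"
    and integral_density_real: "(\<integral>x. f x \<partial>density P (\<lambda>x. ennreal (q x))) = (\<integral>x. max 0 (q x) * f x \<partial>P)"
proof -
  have [measurable]: "f \<in> borel_measurable P" "q \<in> borel_measurable P"
    using f q by (auto simp: bounded_measurable_def)
  obtain C where C: "\<And>x. x \<in> space P \<Longrightarrow> \<bar>f x\<bar> \<le> C"
    using f unfolding bounded_measurable_def bounded_iff by auto
  show "integrable P (\<lambda>x. f x * q x)"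
  proof (rule Bochner_Integration.integrable_bound)
    show "integrable P (\<lambda>x. C * q x)"
      using q by simp
    show "AE x in P. norm (f x * q x) \<le> norm (C * q x)"
      using C by (intro AE_I2) (force simp: abs_mult intro!: mult_right_mono)
  qed simp
  have "(\<integral>x. f x \<partial>density P (\<lambda>x. ennreal (max 0 (q x)))) = (\<integral>x. max 0 (q x) *\<^sub>R f x \<partial>P)"
    by (rule integral_density) auto
  then show "(\<integral>x. f x \<partial>density P (\<lambda>x. ennreal (q x))) = (\<integral>x. max 0 (q x) * f x \<partial>P)"
    by simp
qed

lemma signed_integral_density:
  assumes Q: "Q \<in> signed_measures P" and q: "integrable P q"
    and dens: "\<And>A. A \<in> sets P \<Longrightarrow> Q A = (LINT x:A|P. q x)"
    and f: "f \<in> bounded_measurable P"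
  shows "signed_integral P Q f = (\<integral>x. f x * q x \<partial>P)"
proof -
  have neg_dens: "- Q A = (LINT x:A|P. - q x)" if "A \<in> sets P" for A
    using dens[OF that] by (simp add: set_lebesgue_integral_def)
  have neg: "neg_variation P Q = density P (\<lambda>x. ennreal (- q x))"
    unfolding neg_variation_def
    using neg_dens q by (intro pos_variation_eq_density signed_measures_uminus[OF Q]) auto
  have "integrable P (\<lambda>x. max 0 (q x) * f x)" "integrable P (\<lambda>x. max 0 (- q x) * f x)"
    using integrable_mult_bounded_measurable[of P "\<lambda>x. max 0 (q x)", OF _ f]
      integrable_mult_bounded_measurable[of P "\<lambda>x. max 0 (- q x)", OF _ f] q
    by (simp_all add: mult.commute)
  then have "signed_integral P Q f = (\<integral>x. max 0 (q x) * f x - max 0 (- q x) * f x \<partial>P)"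
    using q f by (simp add: signed_integral_def pos_variation_eq_density[OF Q q dens] neg integral_density_real)
  also have "\<dots> = (\<integral>x. f x * q x \<partial>P)"
    by (intro Bochner_Integration.integral_cong refl) (auto simp: max_def)
  finally show ?thesis .
qed

text \<open>\<^const>\<open>RN_deriv\<close> takes values in \<^typ>\<open>ennreal\<close>; since \<open>N\<close> is finite, it agrees almost
  everywhere with an integrable real function.\<close>

lemma (in finite_measure) finite_measure_has_real_density:
  assumes N: "finite_measure N" "sets N = sets M" "absolutely_continuous M N"
  obtains g where "integrable M g" "\<And>A. A \<in> sets M \<Longrightarrow> measure N A = (LINT x:A|M. g x)"
proof -
  obtain D where D [measurable]: "D \<in> borel_measurable M"
      and RN: "AE x in M. RN_deriv M N x = ennreal (D x)" and nonneg: "\<And>x. 0 \<le> D x"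
    using real_RN_deriv[OF N(1) N(3) N(2)] by metis
  have N_eq: "emeasure N A = (\<integral>\<^sup>+x. ennreal (D x * indicator A x) \<partial>M)" if [measurable]: "A \<in> sets M" for A
  proof -
    have "emeasure N A = emeasure (density M (RN_deriv M N)) A"
      using density_RN_deriv[OF N(3) N(2)] by simp
    also have "\<dots> = (\<integral>\<^sup>+x. RN_deriv M N x * indicator A x \<partial>M)"
      by (simp add: emeasure_density)
    also have "\<dots> = (\<integral>\<^sup>+x. ennreal (D x * indicator A x) \<partial>M)"
      using RN by (intro nn_integral_cong_AE, eventually_elim) (auto split: split_indicator)
    finally show ?thesis .
  qed
  have "(\<integral>\<^sup>+x. ennreal (D x) \<partial>M) = emeasure N (space M)"
    by (auto simp: N_eq intro!: nn_integral_cong)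
  also have "\<dots> < \<infinity>"
    using finite_measure.emeasure_finite[OF N(1)] by (simp add: less_top)
  finally have int: "integrable M D"
    using nonneg by (intro integrableI_nonneg) auto
  moreover have "measure N A = (LINT x:A|M. D x)" if A: "A \<in> sets M" for A
    using nonneg A unfolding measure_def N_eq[OF A]
    by (subst integral_eq_nn_integral[symmetric]) (auto simp: set_lebesgue_integral_def mult.commute)
  ultimately show ?thesis
    using that by blast
qed

lemma signed_Radon_Nikodym:
  assumes P: "finite_measure P" and Q: "Q \<in> signed_measures P" and ac: "abs_cont P Q"
  shows "\<exists>q. integrable P q \<and> (\<forall>A\<in>sets P. Q A = (LINT x:A|P. q x))"
proof -
  interpret finite_measure P by (rule P)
  have pos: "absolutely_continuous P (pos_variation P R)"
    if R: "R \<in> signed_measures P" and ac: "abs_cont P R" for R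
    unfolding absolutely_continuous_def
  proof
    fix A assume A: "A \<in> null_sets P"
    have "R B = 0" if "B \<in> sets P" "B \<subseteq> A" for B
      using null_sets_subset[OF A that] ac unfolding abs_cont_def by blast
    moreover have "A \<in> sets P"
      using A by auto
    ultimately have "emeasure (pos_variation P R) A \<le> 0"
      unfolding emeasure_pos_variation[OF R \<open>A \<in> sets P\<close>] by (intro SUP_least) simp
    then show "A \<in> null_sets (pos_variation P R)"
      using A by (auto simp: null_sets_def)
  qed
  obtain g where g: "integrable P g" "\<And>A. A \<in> sets P \<Longrightarrow> measure (pos_variation P Q) A = (LINT x:A|P. g x)"
    using finite_measure_has_real_density[OF finite_measure_pos_variation[OF Q] sets_pos_variation pos[OF Q ac]]
    by blast
  have ac': "abs_cont P (\<lambda>A. - Q A)"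
    using ac by (simp add: abs_cont_def)
  obtain h where h: "integrable P h" "\<And>A. A \<in> sets P \<Longrightarrow> measure (neg_variation P Q) A = (LINT x:A|P. h x)"
    using finite_measure_has_real_density[OF finite_measure_neg_variation[OF Q] sets_neg_variation
        pos[OF signed_measures_uminus[OF Q] ac', folded neg_variation_def]]
    by blast
  have "Q A = (LINT x:A|P. g x - h x)" if A: "A \<in> sets P" for A
    using A g h integrable_mult_indicator[OF A g(1)] integrable_mult_indicator[OF A h(1)]
    by (simp add: Jordan_decomposition[OF Q A] set_integral_diff set_integrable_def)
  then show ?thesis
    using g(1) h(1) by (intro exI[of _ "\<lambda>x. g x - h x"]) auto
qed

text \<open>\<^const>\<open>signed_RN_deriv\<close> is a \<^const>\<open>Eps\<close> choice; by \<open>signed_Radon_Nikodym\<close> it is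
  made from a nonempty set.\<close>

lemma
  assumes "finite_measure P" "Q \<in> signed_measures P" "abs_cont P Q"
  shows integrable_signed_RN_deriv: "integrable P (signed_RN_deriv P Q)"
    and signed_RN_deriv_density: "A \<in> sets P \<Longrightarrow> Q A = (LINT x:A|P. signed_RN_deriv P Q x)"
  using someI_ex[OF signed_Radon_Nikodym[OF assms]] unfolding signed_RN_deriv_def by blast+

section \<open>Closed convex functions as suprema of affine functions\<close>

text \<open>A convex function is continuous inside its domain and infinite outside the closure of it.  At a finite
  endpoint one side is governed by closedness, and on the other side the function is infinite.\<close>

lemma closed_convex_lower_semicontinuous:
  fixes \<phi> :: "real \<Rightarrow> ennreal" and a b :: ereal
  assumes convex: "\<And>x y t. 0 \<le> t \<Longrightarrow> t \<le> 1 \<Longrightarrow>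
        \<phi> ((1 - t) * x + t * y) \<le> ennreal (1 - t) * \<phi> x + ennreal t * \<phi> y"
    and closed_left: "\<And>r. a = ereal r \<Longrightarrow> (\<phi> \<longlongrightarrow> \<phi> r) (at_right r)"
    and closed_right: "\<And>r. b = ereal r \<Longrightarrow> (\<phi> \<longlongrightarrow> \<phi> r) (at_left r)"
    and domain: "{x. a < ereal x \<and> ereal x < b} \<subseteq> {x. \<phi> x < \<infinity>}"
      "{x. \<phi> x < \<infinity>} \<subseteq> {x. a \<le> ereal x \<and> ereal x \<le> b}"
    and c: "c < \<phi> x"
  shows "\<forall>\<^sub>F y in nhds x. c < \<phi> y"
proof -
  have outside: "c < \<phi> y" if "ereal y < a \<or> b < ereal y" for y
  proof -
    have "\<phi> y = \<infinity>"
      using domain(2) that by (auto simp: less_top[symmetric] not_le)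
    then show ?thesis
      using order_less_le_trans[OF c, of \<top>] by simp
  qed
  have open_below: "open {y. ereal y < a}" and open_above: "open {y. b < ereal y}"
    by (intro open_Collect_less continuous_intros)+
  consider "ereal x < a" | "b < ereal x" | "a = ereal x" | "b = ereal x" | "a < ereal x" "ereal x < b"
    by fastforce
  then show ?thesis
  proof cases
    case 1
    then have "\<forall>\<^sub>F y in nhds x. y \<in> {y. ereal y < a}"
      using open_below by (intro eventually_nhds_in_open) auto
    then show ?thesis
      by eventually_elim (use outside in auto)
  next
    case 2
    then have "\<forall>\<^sub>F y in nhds x. y \<in> {y. b < ereal y}"
      using open_above by (intro eventually_nhds_in_open) auto
    then show ?thesis
      by eventually_elim (use outside in auto)
  next
    case 3
    have "\<forall>\<^sub>F y in at_right x. c < \<phi> y"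
      using order_tendstoD(1)[OF closed_left[OF 3] c] .
    moreover have "\<forall>\<^sub>F y in at_left x. c < \<phi> y"
      unfolding eventually_at_filter using outside 3 by (intro always_eventually) auto
    ultimately show ?thesis
      using c by (simp add: eventually_nhds_conv_at eventually_at_split)
  next
    case 4
    have "\<forall>\<^sub>F y in at_left x. c < \<phi> y"
      using order_tendstoD(1)[OF closed_right[OF 4] c] .
    moreover have "\<forall>\<^sub>F y in at_right x. c < \<phi> y"
      unfolding eventually_at_filter using outside 4 by (intro always_eventually) auto
    ultimately show ?thesis
      using c by (simp add: eventually_nhds_conv_at eventually_at_split)
  next
    case 5
    define S where "S = {y. a < ereal y} \<inter> {y. ereal y < b}"
    have S: "open S"
      unfolding S_def by (intro open_Int open_Collect_less continuous_intros)
    have interval: "is_interval S"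
      unfolding is_interval_1 S_def by (auto intro: less_le_trans le_less_trans simp flip: ereal_less_eq(3))
    define f where "f y = enn2real (\<phi> y)" for y
    have \<phi>_eq: "\<phi> y = ennreal (f y)" if "y \<in> S" for y
      using that domain(1) by (auto simp: S_def f_def)
    have "convex_on S f"
    proof (rule convex_onI)
      fix t u v :: real
      assume t: "0 < t" "t < 1" and uv: "u \<in> S" "v \<in> S"
      have "(1 - t) *\<^sub>R u + t *\<^sub>R v \<in> S"
        using interval t uv by (intro convexD) (auto simp: is_interval_convex)
      then have "ennreal (f ((1 - t) *\<^sub>R u + t *\<^sub>R v)) \<le> ennreal (1 - t) * ennreal (f u) + ennreal t * ennreal (f v)"
        using convex[of t u v] t uv by (simp add: \<phi>_eq)
      also have "\<dots> = ennreal ((1 - t) * f u + t * f v)"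
        using t by (simp add: f_def ennreal_mult ennreal_plus)
      finally show "f ((1 - t) *\<^sub>R u + t *\<^sub>R v) \<le> (1 - t) * f u + t * f v"
        using t by (subst (asm) ennreal_le_iff) (auto simp: f_def)
    qed (use interval in \<open>simp add: is_interval_convex\<close>)
    then have "continuous_on S f"
      by (rule convex_on_continuous[OF S])
    moreover have x: "x \<in> S"
      using 5 by (auto simp: S_def)
    ultimately have "(f \<longlongrightarrow> f x) (nhds x)"
      using S by (simp add: continuous_on_eq_continuous_at isCont_def tendsto_at_iff_tendsto_nhds)
    then have "((\<lambda>y. ennreal (f y)) \<longlongrightarrow> ennreal (f x)) (nhds x)"
      by (rule tendsto_ennrealI)
    then have "\<forall>\<^sub>F y in nhds x. c < ennreal (f y)"
      using c \<phi>_eq[OF x] by (intro order_tendstoD(1)) auto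
    moreover have "\<forall>\<^sub>F y in nhds x. y \<in> S"
      using S x by (rule eventually_nhds_in_open)
    ultimately show ?thesis
      by eventually_elim (simp add: \<phi>_eq)
  qed
qed

text \<open>By lower semicontinuity the epigraph is closed, so a line separates it strictly from the point
  \<open>(x, c)\<close> below the graph.  A line that is not vertical is the graph of the affine minorant.  A
  vertical one separates \<open>x\<close> from the domain: an affine function that vanishes on the line and is
  negative over the domain is a minorant because \<open>\<phi>\<close> is nonnegative, and scaling it makes its value
  at \<open>x\<close> as large as desired.\<close>

lemma affine_minorant_above:
  fixes \<phi> :: "real \<Rightarrow> ennreal"
  assumes convex: "\<And>x y t. 0 \<le> t \<Longrightarrow> t \<le> 1 \<Longrightarrow>
        \<phi> ((1 - t) * x + t * y) \<le> ennreal (1 - t) * \<phi> x + ennreal t * \<phi> y"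
    and lsc: "\<And>c x. c < \<phi> x \<Longrightarrow> \<forall>\<^sub>F y in nhds x. c < \<phi> y"
    and proper: "\<phi> x0 < \<infinity>"
    and c: "ennreal c < \<phi> x" "0 \<le> c"
  obtains \<alpha> \<beta> where "\<And>y. ennreal (\<alpha> * y - \<beta>) \<le> \<phi> y" "c < \<alpha> * x - \<beta>"
proof -
  define epi where "epi = {(y, t). 0 \<le> t \<and> \<phi> y \<le> ennreal t}"
  have conv: "convex epi"
    unfolding convex_alt
  proof (intro ballI allI impI)
    fix z w :: "real \<times> real" and t :: real
    assume zw: "z \<in> epi" "w \<in> epi" and t: "0 \<le> t \<and> t \<le> 1"
    obtain y r y' r' where eq: "z = (y, r)" "w = (y', r')"
      by fastforce
    have r: "0 \<le> r" "\<phi> y \<le> ennreal r" "0 \<le> r'" "\<phi> y' \<le> ennreal r'"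
      using zw by (auto simp: epi_def eq)
    have "\<phi> ((1 - t) * y + t * y') \<le> ennreal (1 - t) * \<phi> y + ennreal t * \<phi> y'"
      using t by (intro convex) auto
    also have "\<dots> \<le> ennreal (1 - t) * ennreal r + ennreal t * ennreal r'"
      using r by (intro add_mono mult_left_mono) auto
    also have "\<dots> = ennreal ((1 - t) * r + t * r')"
      using r t by (simp add: ennreal_mult ennreal_plus)
    finally show "(1 - t) *\<^sub>R z + t *\<^sub>R w \<in> epi"
      using r t by (auto simp: epi_def eq)
  qed
  have "closed epi"
    unfolding closed_sequential_limits
  proof (intro allI impI, elim conjE)
    fix z :: "nat \<Rightarrow> real \<times> real" and w
    assume z: "\<forall>n. z n \<in> epi" and lim: "z \<longlonglongrightarrow> w"
    have fst: "(\<lambda>n. fst (z n)) \<longlonglongrightarrow> fst w" and snd: "(\<lambda>n. snd (z n)) \<longlonglongrightarrow> snd w"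
      using lim by (auto intro: tendsto_fst tendsto_snd)
    have "0 \<le> snd w"
      using snd z by (intro LIMSEQ_le_const) (auto simp: epi_def split_beta)
    moreover have "\<phi> (fst w) \<le> ennreal (snd w)"
    proof (rule ccontr)
      assume "\<not> \<phi> (fst w) \<le> ennreal (snd w)"
      then obtain d where d: "ennreal (snd w) < d" "d < \<phi> (fst w)"
        using dense by (auto simp: not_le)
      have "\<forall>\<^sub>F n in sequentially. d < \<phi> (fst (z n))"
        using lsc[OF d(2)] fst by (rule eventually_compose_filterlim)
      moreover have "\<forall>\<^sub>F n in sequentially. ennreal (snd (z n)) < d"
        using tendsto_ennrealI[OF snd] d(1) by (rule order_tendstoD(2))
      ultimately have "\<forall>\<^sub>F n in sequentially. False"
      proof eventually_elim
        case (elim n)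
        then show ?case
          using z by (auto simp: epi_def split_beta dest!: spec[of _ n])
      qed
      then show False by simp
    qed
    ultimately show "w \<in> epi"
      by (auto simp: epi_def split_beta)
  qed
  moreover have "(x, c) \<notin> epi"
    using c by (auto simp: epi_def)
  ultimately obtain k d where sep: "k \<bullet> (x, c) < d" "\<And>z. z \<in> epi \<Longrightarrow> d < k \<bullet> z"
    using separating_hyperplane_closed_point[OF conv] by metis
  obtain u v where k: "k = (u, v)"
    by fastforce
  have at_x: "u * x + v * c < d"
    using sep(1) by (simp add: k)
  have above: "d < u * y + v * t" if "0 \<le> t" "\<phi> y \<le> ennreal t" for y t
    using sep(2)[of "(y, t)"] that by (simp add: epi_def k)
  have above_\<phi>: "d < u * y + v * enn2real (\<phi> y)" if "\<phi> y < \<infinity>" for y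
    using that by (intro above) auto
  have "v \<ge> 0"
  proof (rule ccontr)
    assume v: "\<not> v \<ge> 0"
    \<comment> \<open>Going up far enough over \<open>x0\<close> stays in the epigraph but would cross the line.\<close>
    define t where "t = max (enn2real (\<phi> x0)) ((d - u * x0) / v)"
    have "\<phi> x0 = ennreal (enn2real (\<phi> x0))"
      using proper by simp
    also have "\<dots> \<le> ennreal t"
      by (intro ennreal_leI) (simp add: t_def)
    finally have "\<phi> x0 \<le> ennreal t" .
    then have "d < u * x0 + v * t"
      by (intro above) (auto simp: t_def le_max_iff_disj)
    moreover have "v * t \<le> v * ((d - u * x0) / v)"
      using v by (intro mult_left_mono_neg) (auto simp: t_def)
    ultimately show False
      using v by simp
  qed
  then consider "v > 0" | "v = 0"
    by fastforce
  then show ?thesis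
  proof cases
    case 1
    show ?thesis
    proof (rule that[of "- u / v" "- d / v"])
      fix y
      show "ennreal (- u / v * y - - d / v) \<le> \<phi> y"
      proof (cases "\<phi> y < \<infinity>")
        case True
        have "- u / v * y - - d / v \<le> enn2real (\<phi> y)"
          using above_\<phi>[OF True] 1 by (simp add: field_simps)
        then have "ennreal (- u / v * y - - d / v) \<le> ennreal (enn2real (\<phi> y))"
          by (rule ennreal_leI)
        also have "\<dots> = \<phi> y"
          using True by simp
        finally show ?thesis .
      qed (simp add: not_less top_unique)
    next
      show "c < - u / v * x - - d / v"
        using at_x 1 by (simp add: field_simps)
    qed
  next
    case 2
    \<comment> \<open>The scaling that gives the minorant \<open>m * (d - u * y)\<close> the value \<open>c + 1\<close> at \<open>x\<close>.\<close>
    define m where "m = (c + 1) / (d - u * x)"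
    have m: "0 < m"
      using at_x c 2 by (simp add: m_def)
    show ?thesis
    proof (rule that[of "- m * u" "- m * d"])
      fix y
      show "ennreal (- m * u * y - - m * d) \<le> \<phi> y"
      proof (cases "\<phi> y < \<infinity>")
        case True
        have "m * (d - u * y) \<le> 0"
          using above_\<phi>[OF True] 2 m by (intro mult_nonneg_nonpos) auto
        then show ?thesis
          by (simp add: ennreal_neg algebra_simps)
      qed (simp add: not_less top_unique)
    next
      have "m * (d - u * x) = c + 1"
        using at_x 2 by (simp add: m_def)
      then show "c < - m * u * x - - m * d"
        by (simp add: algebra_simps)
    qed
  qed
qed

text \<open>The pairs of slope and intercept of all affine minorants form a subset of the plane.  A countable
  dense part of it suffices, because the value of an affine function at a given point depends continuously on
  the pair.  Rounding to rational pairs would not do, as it can destroy the minorant property.\<close>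

lemma countable_sup_of_affine_minorants:
  fixes \<phi> :: "real \<Rightarrow> ennreal"
  assumes convex: "\<And>x y t. 0 \<le> t \<Longrightarrow> t \<le> 1 \<Longrightarrow>
        \<phi> ((1 - t) * x + t * y) \<le> ennreal (1 - t) * \<phi> x + ennreal t * \<phi> y"
    and lsc: "\<And>c x. c < \<phi> x \<Longrightarrow> \<forall>\<^sub>F y in nhds x. c < \<phi> y"
    and proper: "\<phi> x0 < \<infinity>"
  obtains \<alpha> \<beta> :: "nat \<Rightarrow> real" where "\<And>y. \<phi> y = (SUP n. ennreal (\<alpha> n * y - \<beta> n))"
proof -
  define E where "E = {(\<alpha>, \<beta>). \<forall>y. ennreal (\<alpha> * y - \<beta>) \<le> \<phi> y}"
  obtain D where D: "countable D" "D \<subseteq> E" "E \<subseteq> closure D"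
    by (rule separable)
  have "(0, 0) \<in> E"
    by (simp add: E_def)
  then have "D \<noteq> {}"
    using D(3) by auto
  then have range: "range (from_nat_into D) = D"
    using D(1) by (simp add: range_from_nat_into)
  show ?thesis
  proof (rule that[of "\<lambda>n. fst (from_nat_into D n)" "\<lambda>n. snd (from_nat_into D n)"])
    fix x
    let ?s = "SUP n. ennreal (fst (from_nat_into D n) * x - snd (from_nat_into D n))"
    have "from_nat_into D n \<in> E" for n
      using range D(2) by blast
    then have "?s \<le> \<phi> x"
      by (intro SUP_least) (auto simp: E_def split_beta)
    moreover have "\<phi> x \<le> ?s"
    proof (rule ccontr)
      assume "\<not> \<phi> x \<le> ?s"
      then have less: "?s < \<phi> x"
        by simp
      then obtain c where c: "?s = ennreal c" "0 \<le> c"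
        by (cases ?s) auto
      obtain \<alpha> \<beta> where \<alpha>\<beta>: "\<And>y. ennreal (\<alpha> * y - \<beta>) \<le> \<phi> y" "c < \<alpha> * x - \<beta>"
        using affine_minorant_above[OF convex lsc proper] less c by metis
      define U where "U = {z :: real \<times> real. c < fst z * x - snd z}"
      have "open U"
        unfolding U_def by (intro open_Collect_less continuous_intros)
      moreover have "(\<alpha>, \<beta>) \<in> U \<inter> closure D"
        using \<alpha>\<beta> D(3) by (auto simp: U_def E_def)
      ultimately obtain z where z: "z \<in> U" "z \<in> D"
        by (metis IntE IntI disjoint_iff open_Int_closure_eq_empty)
      then obtain n where n: "z = from_nat_into D n"
        using range by blast
      have "ennreal (fst z * x - snd z) \<le> ennreal c"
        unfolding c(1)[symmetric] n by (rule SUP_upper) simp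
      then show False
        using z(1) c(2) by (simp add: U_def)
    qed
    ultimately show "\<phi> x = ?s"
      by (rule antisym[rotated])
  qed
qed

text \<open>\<open>s y\<close> and \<open>i y\<close> are the slope and the intercept of an affine minorant that dominates, at
  \<open>y\<close>, the zero function and the first \<open>n\<close> members of the family.  Beginning with the zero
  function keeps the selected value nonnegative, so that its integral is not affected by the truncation
  in \<^const>\<open>ennreal\<close>.\<close>

lemma measurable_affine_selection:
  fixes \<phi> :: "real \<Rightarrow> ennreal" and \<alpha> \<beta> :: "nat \<Rightarrow> real"
  assumes "\<And>k y. ennreal (\<alpha> k * y - \<beta> k) \<le> \<phi> y"
  shows "\<exists>s i :: real \<Rightarrow> real. s \<in> borel_measurable borel \<and> i \<in> borel_measurable borel \<and>
           finite (range s) \<and> finite (range i) \<and>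
           (\<forall>y z. ennreal (s y * z - i y) \<le> \<phi> z) \<and>
           (\<forall>y. 0 \<le> s y * y - i y) \<and> (\<forall>y. \<forall>k<n. \<alpha> k * y - \<beta> k \<le> s y * y - i y)"
proof (induction n)
  case 0
  show ?case
    by (intro exI[of _ "\<lambda>_. 0"]) auto
next
  case (Suc n)
  then obtain s i :: "real \<Rightarrow> real" where
      [measurable]: "s \<in> borel_measurable borel" "i \<in> borel_measurable borel"
      and fin: "finite (range s)" "finite (range i)"
      and below: "\<And>y z. ennreal (s y * z - i y) \<le> \<phi> z"
      and nonneg: "\<And>y. 0 \<le> s y * y - i y"
      and max: "\<And>y k. k < n \<Longrightarrow> \<alpha> k * y - \<beta> k \<le> s y * y - i y"
    by blast
  define better where "better y \<longleftrightarrow> s y * y - i y < \<alpha> n * y - \<beta> n" for y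
  have [measurable]: "Measurable.pred borel better"
    unfolding better_def by measurable
  have "finite (range (\<lambda>y. if better y then \<alpha> n else s y))"
    by (rule finite_subset[of _ "insert (\<alpha> n) (range s)"]) (use fin in auto)
  moreover have "finite (range (\<lambda>y. if better y then \<beta> n else i y))"
    by (rule finite_subset[of _ "insert (\<beta> n) (range i)"]) (use fin in auto)
  moreover have "\<alpha> k * y - \<beta> k \<le>
      (if better y then \<alpha> n else s y) * y - (if better y then \<beta> n else i y)" if "k < Suc n" for k y
    using max[of k y] that by (cases "k = n") (auto simp: better_def)
  moreover have "0 \<le> (if better y then \<alpha> n else s y) * y - (if better y then \<beta> n else i y)" for y
    using nonneg[of y] by (auto simp: better_def)
  ultimately show ?case
    using below assms
    by (intro exI[of _ "\<lambda>y. if better y then \<alpha> n else s y"] exI[of _ "\<lambda>y. if better y then \<beta> n else i y"])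
      auto
qed

section \<open>Duality\<close>

lemma bounded_measurable_subset_test_functions: "bounded_measurable M \<subseteq> test_functions M F"
proof
  fix f assume "f \<in> bounded_measurable M"
  then show "f \<in> test_functions M F"
    unfolding test_functions_def fun_span_def
    by (auto intro!: exI[of _ "{f}"] exI[of _ "\<lambda>_. 1"])
qed

lemma weak_duality:
  assumes "Q \<in> signed_measures_F P F"
  shows "ereal (signed_integral P Q f) - phi_star \<phi> P F f \<le> enn2ereal (phi_divergence \<phi> P Q)"
proof -
  have "ereal (signed_integral P Q f) - enn2ereal (phi_divergence \<phi> P Q) \<le> phi_star \<phi> P F f"
    unfolding phi_star_def using assms by (rule SUP_upper)
  then show ?thesis
    by (cases "enn2ereal (phi_divergence \<phi> P Q)"; cases "phi_star \<phi> P F f") auto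
qed

text \<open>The hypothesis says that \<open>i x\<close> dominates the conjugate of \<open>\<phi>\<close> at \<open>f x\<close>; this is the
  upper half of the formula that expresses \<open>\<phi>*(f)\<close> as the integral of that conjugate.
  Measures that are not absolutely continuous contribute \<open>-\<infinity>\<close> to the supremum.\<close>

lemma phi_star_le_integral_intercept:
  assumes P: "finite_measure P" and f: "f \<in> bounded_measurable P" and i: "integrable P i"
    and below: "\<And>x z. ennreal (f x * z - i x) \<le> \<phi> z"
  shows "phi_star \<phi> P F f \<le> ereal (\<integral>x. i x \<partial>P)"
  unfolding phi_star_def
proof (rule SUP_least)
  fix R assume "R \<in> signed_measures_F P F"
  then have R: "R \<in> signed_measures P"
    by (simp add: signed_measures_F_def)
  show "ereal (signed_integral P R f) - enn2ereal (phi_divergence \<phi> P R) \<le> ereal (\<integral>x. i x \<partial>P)"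
  proof (cases "abs_cont P R")
    case True
    define r where "r = signed_RN_deriv P R"
    have r: "integrable P r"
      unfolding r_def by (rule integrable_signed_RN_deriv[OF P R True])
    have fr: "integrable P (\<lambda>x. f x * r x)"
      by (rule integrable_mult_bounded_measurable[OF r f])
    have int: "signed_integral P R f = (\<integral>x. f x * r x \<partial>P)"
      unfolding r_def
      by (rule signed_integral_density[OF R integrable_signed_RN_deriv[OF P R True] signed_RN_deriv_density[OF P R True] f])
    have "ennreal ((\<integral>x. f x * r x \<partial>P) - (\<integral>x. i x \<partial>P)) = ennreal (\<integral>x. f x * r x - i x \<partial>P)"
      using fr i by simp
    also have "\<dots> \<le> (\<integral>\<^sup>+x. ennreal (f x * r x - i x) \<partial>P)"
      using fr i by (intro ennreal_integral_le_nn_integral) simp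
    also have "\<dots> \<le> (\<integral>\<^sup>+x. \<phi> (r x) \<partial>P)"
      by (intro nn_integral_mono below)
    also have "\<dots> = phi_divergence \<phi> P R"
      using True by (simp add: phi_divergence_def r_def)
    finally have le: "ennreal (signed_integral P R f - (\<integral>x. i x \<partial>P)) \<le> phi_divergence \<phi> P R"
      by (simp add: int)
    show ?thesis
    proof (cases "phi_divergence \<phi> P R")
      case (real d)
      then have "signed_integral P R f - (\<integral>x. i x \<partial>P) \<le> d"
        using le by (simp add: ennreal_le_iff)
      then show ?thesis
        using real by (simp add: enn2ereal_ennreal)
    qed (simp add: top_ereal_def)
  qed (simp add: phi_divergence_def top_ereal_def)
qed

text \<open>A multiple of the indicator of a null set charged by \<open>Q\<close> costs nothing in \<^const>\<open>phi_star\<close>,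
  because only measures that ignore the null set have finite divergence.\<close>

lemma dual_value_infinite_if_not_abs_cont:
  assumes Q: "Q \<in> signed_measures_F P F" and sing: "\<not> abs_cont P Q"
  shows "(SUP f\<in>test_functions P F. ereal (signed_integral P Q f) - phi_star \<phi> P F f) = \<infinity>"
proof (rule SUP_PInfty)
  fix n :: nat
  have Q': "Q \<in> signed_measures P"
    using Q by (simp add: signed_measures_F_def)
  obtain A where A: "A \<in> null_sets P" "Q A \<noteq> 0"
    using sing by (auto simp: abs_cont_def)
  then have A' [measurable]: "A \<in> sets P"
    by auto
  \<comment> \<open>Scaled so that the integral of \<open>f\<close> against \<open>Q\<close> is \<open>n\<close>, whatever the sign of \<open>Q A\<close>.\<close>
  define f where "f x = real n / Q A * indicator A x" for x
  have "f \<in> bounded_measurable P"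
    unfolding bounded_measurable_def f_def bounded_iff
    by (auto simp: indicator_def intro!: exI[of _ "\<bar>real n / Q A\<bar>"])
  then have f: "f \<in> test_functions P F"
    using bounded_measurable_subset_test_functions by blast
  have "phi_star \<phi> P F f \<le> 0"
    unfolding phi_star_def
  proof (rule SUP_least)
    fix R assume R: "R \<in> signed_measures_F P F"
    show "ereal (signed_integral P R f) - enn2ereal (phi_divergence \<phi> P R) \<le> 0"
    proof (cases "abs_cont P R")
      case True
      then have "signed_integral P R f = 0"
        using R A unfolding f_def
        by (subst signed_integral_indicator) (auto simp: abs_cont_def signed_measures_F_def)
      then show ?thesis
        by (simp add: ereal_diff_le_self flip: zero_ereal_def)
    qed (simp add: phi_divergence_def top_ereal_def)
  qed
  moreover have "signed_integral P Q f = real n"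
    unfolding f_def using A by (subst signed_integral_indicator[OF Q' A']) simp
  ultimately have "ereal (real n) \<le> ereal (signed_integral P Q f) - phi_star \<phi> P F f"
    by (cases "phi_star \<phi> P F f") auto
  then show "\<exists>f\<in>test_functions P F. ereal (real n) \<le> ereal (signed_integral P Q f) - phi_star \<phi> P F f"
    using f by blast
qed

text \<open>The optimal test function would be a subgradient of \<open>\<phi>\<close> at \<open>q\<close>, which may be unbounded or
  fail to exist at the ends of the domain.  The slopes of the affine functions that are best among the first
  \<open>n\<close> are bounded and come close enough.\<close>

lemma divergence_le_dual_value_if_abs_cont:
  fixes \<phi> :: "real \<Rightarrow> ennreal" and \<alpha> \<beta> :: "nat \<Rightarrow> real"
  assumes P: "finite_measure P" and Q: "Q \<in> signed_measures_F P F" and ac: "abs_cont P Q"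
    and \<phi>: "\<And>y. \<phi> y = (SUP n. ennreal (\<alpha> n * y - \<beta> n))"
  shows "enn2ereal (phi_divergence \<phi> P Q) \<le>
           (SUP f\<in>test_functions P F. ereal (signed_integral P Q f) - phi_star \<phi> P F f)"
    (is "_ \<le> ?dual")
proof -
  interpret finite_measure P by (rule P)
  have Q': "Q \<in> signed_measures P"
    using Q by (simp add: signed_measures_F_def)
  define q where "q = signed_RN_deriv P Q"
  have q: "integrable P q"
    unfolding q_def by (rule integrable_signed_RN_deriv[OF P Q' ac])
  note [measurable] = borel_measurable_integrable[OF q]
  define g where "g n x = (SUP k\<in>{..<n}. ennreal (\<alpha> k * q x - \<beta> k))" for n x
  have [measurable]: "g n \<in> borel_measurable P" for n
    unfolding g_def by measurable
  have minorant: "ennreal (\<alpha> k * y - \<beta> k) \<le> \<phi> y" for k y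
    unfolding \<phi> by (rule SUP_upper) simp
  have bound: "enn2ereal (\<integral>\<^sup>+x. g n x \<partial>P) \<le> ?dual" for n
  proof -
    obtain s i :: "real \<Rightarrow> real" where
      [measurable]: "s \<in> borel_measurable borel" "i \<in> borel_measurable borel"
      and fin: "finite (range s)" "finite (range i)"
      and below: "\<And>y z. ennreal (s y * z - i y) \<le> \<phi> z"
      and nonneg: "\<And>y. 0 \<le> s y * y - i y"
      and max: "\<And>y k. k < n \<Longrightarrow> \<alpha> k * y - \<beta> k \<le> s y * y - i y"
      using measurable_affine_selection[of \<alpha> \<beta> \<phi> n, OF minorant] by blast
    have sq: "(\<lambda>x. s (q x)) \<in> bounded_measurable P"
      unfolding bounded_measurable_def
      using bounded_subset[OF finite_imp_bounded[OF fin(1)], of "(\<lambda>x. s (q x)) ` space P"] by auto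
    obtain C where C: "\<And>y. \<bar>i y\<bar> \<le> C"
      using finite_imp_bounded[OF fin(2)] unfolding bounded_iff by auto
    have iq: "integrable P (\<lambda>x. i (q x))"
      using C by (intro integrable_const_bound[where B = C]) auto
    have sqq: "integrable P (\<lambda>x. s (q x) * q x)"
      by (rule integrable_mult_bounded_measurable[OF q sq])
    have int: "signed_integral P Q (\<lambda>x. s (q x)) = (\<integral>x. s (q x) * q x \<partial>P)"
      using signed_RN_deriv_density[OF P Q' ac, folded q_def]
      by (rule signed_integral_density[OF Q' q _ sq])
    have "(\<integral>\<^sup>+x. g n x \<partial>P) \<le> (\<integral>\<^sup>+x. ennreal (s (q x) * q x - i (q x)) \<partial>P)"
      unfolding g_def by (intro nn_integral_mono SUP_least ennreal_leI max) simp
    also have "\<dots> = ennreal (\<integral>x. s (q x) * q x - i (q x) \<partial>P)"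
      using sqq iq nonneg by (intro nn_integral_eq_integral) auto
    finally have "(\<integral>\<^sup>+x. g n x \<partial>P) \<le> ennreal (\<integral>x. s (q x) * q x - i (q x) \<partial>P)" .
    moreover have "0 \<le> (\<integral>x. s (q x) * q x - i (q x) \<partial>P)"
      by (intro integral_nonneg_AE AE_I2 nonneg)
    ultimately have "enn2ereal (\<integral>\<^sup>+x. g n x \<partial>P) \<le> ereal (\<integral>x. s (q x) * q x - i (q x) \<partial>P)"
      by (simp only: less_eq_ennreal.rep_eq enn2ereal_ennreal)
    also have "\<dots> = ereal (signed_integral P Q (\<lambda>x. s (q x))) - ereal (\<integral>x. i (q x) \<partial>P)"
      using sqq iq by (simp add: int)
    also have "\<dots> \<le> ereal (signed_integral P Q (\<lambda>x. s (q x))) - phi_star \<phi> P F (\<lambda>x. s (q x))"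
      by (intro ereal_minus_mono order_refl phi_star_le_integral_intercept[OF P sq iq] below)
    also have "\<dots> \<le> ?dual"
      using sq bounded_measurable_subset_test_functions by (intro SUP_upper) blast
    finally show ?thesis .
  qed
  have "phi_divergence \<phi> P Q = (\<integral>\<^sup>+x. (SUP n. g n x) \<partial>P)"
  proof -
    have "\<phi> (q x) = (SUP n. g n x)" for x
    proof (rule antisym)
      show "\<phi> (q x) \<le> (SUP n. g n x)"
        unfolding \<phi> g_def
        by (intro SUP_least SUP_upper2[of "Suc _"] SUP_upper) auto
      show "(SUP n. g n x) \<le> \<phi> (q x)"
        unfolding g_def by (intro SUP_least minorant)
    qed
    then show ?thesis
      using ac by (simp add: phi_divergence_def q_def)
  qed
  also have "\<dots> = (SUP n. \<integral>\<^sup>+x. g n x \<partial>P)"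
    by (intro nn_integral_monotone_convergence_SUP)
      (auto simp: g_def mono_def le_fun_def intro!: SUP_subset_mono)
  also have "\<dots> \<le> e2ennreal ?dual"
    using e2ennreal_mono[OF bound] by (intro SUP_least) simp
  finally have "enn2ereal (phi_divergence \<phi> P Q) \<le> enn2ereal (e2ennreal ?dual)"
    by (simp add: less_eq_ennreal.rep_eq)
  also have "\<dots> = ?dual"
    using order_trans[OF enn2ereal_nonneg bound] by (rule enn2ereal_e2ennreal)
  finally show ?thesis .
qed

theorem theorem4p1:
  fixes P :: "'a measure"
    and \<phi> :: "real \<Rightarrow> ennreal"
    and a b :: ereal
    and F :: "('a \<Rightarrow> real) set"
  assumes prob: "prob_space P"
    and proper: "\<exists>x. \<phi> x < \<infinity>"
    and convex: "\<And>x y t. 0 \<le> t \<Longrightarrow> t \<le> 1 \<Longrightarrow>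
        \<phi> ((1 - t) * x + t * y) \<le> ennreal (1 - t) * \<phi> x + ennreal t * \<phi> y"
    and closed_left: "\<And>r. a = ereal r \<Longrightarrow> (\<phi> \<longlongrightarrow> \<phi> r) (at_right r)"
    and closed_right: "\<And>r. b = ereal r \<Longrightarrow> (\<phi> \<longlongrightarrow> \<phi> r) (at_left r)"
    and phi_one: "\<phi> 1 = 0"
    and endpoints: "a < 1" "1 < b"
    and domain: "{x. a < ereal x \<and> ereal x < b} \<subseteq> {x. \<phi> x < \<infinity>}"
      "{x. \<phi> x < \<infinity>} \<subseteq> {x. a \<le> ereal x \<and> ereal x \<le> b}"
    and F_measurable: "F \<subseteq> borel_measurable P"
  shows "(\<forall>Q\<in>topspace (tau_F P F).
            enn2ereal (phi_divergence \<phi> P Q) =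
              conjugate (tau_M P F) (\<lambda>f Q. signed_integral P Q f)
                (conjugate (tau_F P F) (\<lambda>Q f. signed_integral P Q f)
                   (\<lambda>Q. enn2ereal (phi_divergence \<phi> P Q))) Q)
       \<and> (\<forall>Q\<in>signed_measures_F P F.
            enn2ereal (phi_divergence \<phi> P Q) =
              (SUP f\<in>test_functions P F. ereal (signed_integral P Q f) - phi_star \<phi> P F f))"
proof -
  have P: "finite_measure P"
    using prob by (rule prob_space.axioms)
  have lsc: "\<And>c x. c < \<phi> x \<Longrightarrow> \<forall>\<^sub>F y in nhds x. c < \<phi> y"
    using closed_convex_lower_semicontinuous[of \<phi> a b, OF convex closed_left closed_right domain] .
  obtain x0 where "\<phi> x0 < \<infinity>"
    using proper by blast
  then obtain \<alpha> \<beta> where \<phi>: "\<And>y. \<phi> y = (SUP n::nat. ennreal (\<alpha> n * y - \<beta> n))"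
    using countable_sup_of_affine_minorants[of \<phi>, OF convex lsc] by metis
  have dual: "enn2ereal (phi_divergence \<phi> P Q) =
      (SUP f\<in>test_functions P F. ereal (signed_integral P Q f) - phi_star \<phi> P F f)"
    if Q: "Q \<in> signed_measures_F P F" for Q
  proof (rule antisym)
    show "enn2ereal (phi_divergence \<phi> P Q) \<le>
        (SUP f\<in>test_functions P F. ereal (signed_integral P Q f) - phi_star \<phi> P F f)"
    proof (cases "abs_cont P Q")
      case True
      then show ?thesis
        by (rule divergence_le_dual_value_if_abs_cont[OF P Q _ \<phi>])
    next
      case False
      then show ?thesis
        by (simp add: dual_value_infinite_if_not_abs_cont[OF Q])
    qed
    show "(SUP f\<in>test_functions P F. ereal (signed_integral P Q f) - phi_star \<phi> P F f)
        \<le> enn2ereal (phi_divergence \<phi> P Q)"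
      by (intro SUP_least weak_duality[OF Q])
  qed
  have top: "topspace (tau_F P F) = signed_measures_F P F" "topspace (tau_M P F) = test_functions P F"
    unfolding tau_F_def tau_M_def by (rule topspace_weakest_topology)+
  have "conjugate (tau_F P F) (\<lambda>Q f. signed_integral P Q f)
      (\<lambda>Q. enn2ereal (phi_divergence \<phi> P Q)) = phi_star \<phi> P F"
    unfolding conjugate_def top phi_star_def ..
  then show ?thesis
    using dual by (simp add: conjugate_def top)
qed

end
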